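(* Let $k \ge 3$ be an integer. For every instance $I$ of the online transportation problem, $\mathrm{GREEDY}_k(I) \le \left(1 + \frac{2}{k-2}\right)\mathrm{OPT}(I)$.
   Context: Online transportation problem: a metric space $\mathcal{M}$ with distance $d$ contains server sites $s_1,\dots,s_m$ at given locations; site $s_j$ has a positive integer capacity $a_j$. Requests $r_1,\dots,r_n$ arrive one at a time at locations in $\mathcal{M}$ (with $n \le \sum_j a_j$). An instance $I$ consists of the sites, capacities and request sequence. $\mathrm{OPT}(I)$ is the minimum, over all assignments of requests to sites in which each site $s_j$ receives at most $a_j$ requests, of the total distance $\sum_i d(r_i, \text{site assigned to } r_i)$. $\mathrm{GREEDY}$ is the online algorithm that, upon arrival of each request, irrevocably assigns it to a nearest site that is not yet full (ties broken arbitrarily). $\mathrm{GREEDY}_k(I)$ is the total distance incurred by $\mathrm{GREEDY}$ on instance $I$ when each site $s_j$ is given the augmented capacity $c_j = k\,a_j$ (while $\mathrm{OPT}(I)$ uses the original capacities $a_j$). *)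

theory Defs
  imports "HOL-Analysis.Analysis"
begin

text \<open>
  Sites are indexed by \<open>j < num_sites I\<close> and requests, in order of arrival, by \<open>i < num_reqs I\<close>.
  Only the values of \<open>site\<close>, \<open>cap\<close> and \<open>req\<close> at such indices matter.
  Different sites may be at the same location.
\<close>

record 'a transport =
  num_sites :: nat
  site :: "nat \<Rightarrow> 'a"
  cap :: "nat \<Rightarrow> nat"
  num_reqs :: nat
  req :: "nat \<Rightarrow> 'a"

definition transport_instance :: "'a set \<Rightarrow> 'a transport \<Rightarrow> bool" where
  "transport_instance M I \<longleftrightarrow>
     (\<forall>j<num_sites I. site I j \<in> M \<and> 0 < cap I j) \<and>
     (\<forall>i<num_reqs I. req I i \<in> M) \<and>
     num_reqs I \<le> (\<Sum>j<num_sites I. cap I j)"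

definition assignments :: "'a transport \<Rightarrow> (nat \<Rightarrow> nat) set" where
  "assignments I = {..<num_reqs I} \<rightarrow>\<^sub>E {..<num_sites I}"

definition total_distance :: "('a \<Rightarrow> 'a \<Rightarrow> real) \<Rightarrow> 'a transport \<Rightarrow> (nat \<Rightarrow> nat) \<Rightarrow> real" where
  "total_distance d I f = (\<Sum>i<num_reqs I. d (req I i) (site I (f i)))"

text \<open>\<open>load f i j\<close> counts the requests assigned to site \<open>j\<close> just before request \<open>i\<close> arrives.\<close>

definition load :: "(nat \<Rightarrow> nat) \<Rightarrow> nat \<Rightarrow> nat \<Rightarrow> nat" where
  "load f i j = card {i'. i' < i \<and> f i' = j}"

definition feasible :: "'a transport \<Rightarrow> (nat \<Rightarrow> nat) set" where
  "feasible I = {f \<in> assignments I. \<forall>j<num_sites I. load f (num_reqs I) j \<le> cap I j}"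

definition OPT :: "('a \<Rightarrow> 'a \<Rightarrow> real) \<Rightarrow> 'a transport \<Rightarrow> real" where
  "OPT d I = Min (total_distance d I ` feasible I)"

text \<open>
  A run of the greedy algorithm with capacities \<open>c\<close>. Ties may be broken in any way, so an instance
  can have several runs.
\<close>

definition greedy_run ::
  "('a \<Rightarrow> 'a \<Rightarrow> real) \<Rightarrow> 'a transport \<Rightarrow> (nat \<Rightarrow> nat) \<Rightarrow> (nat \<Rightarrow> nat) \<Rightarrow> bool" where
  "greedy_run d I c f \<longleftrightarrow>
     f \<in> assignments I \<and>
     (\<forall>i<num_reqs I.
        load f i (f i) < c (f i) \<and>
        (\<forall>j<num_sites I. load f i j < c j \<longrightarrow>
           d (req I i) (site I (f i)) \<le> d (req I i) (site I j)))"

text \<open>The set of all total distances greedy can incur with capacities multiplied by \<open>k\<close>.\<close>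

definition GREEDY :: "('a \<Rightarrow> 'a \<Rightarrow> real) \<Rightarrow> nat \<Rightarrow> 'a transport \<Rightarrow> real set" where
  "GREEDY d k I = {total_distance d I f | f. greedy_run d I (\<lambda>j. k * cap I j) f}"

text \<open>Greedy runs exist, and \<open>OPT\<close> is the minimum of a finite nonempty set.\<close>

lemma load_0 [simp]: "load f 0 j = 0"
  by (simp add: load_def)

lemma load_Suc: "load f (Suc i) j = load f i j + (if f i = j then 1 else 0)"
proof -
  have "{i'. i' < Suc i \<and> f i' = j} = {i'. i' < i \<and> f i' = j} \<union> (if f i = j then {i} else {})"
    by (auto simp: less_Suc_eq)
  then show ?thesis
    by (auto simp: load_def)
qed

lemma load_cong: "(\<And>i'. i' < i \<Longrightarrow> f i' = g i') \<Longrightarrow> load f i j = load g i j"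
  unfolding load_def by (metis (mono_tags, lifting))

lemma sum_load:
  assumes "\<And>i'. i' < i \<Longrightarrow> f i' < m"
  shows "(\<Sum>j<m. load f i j) = i"
  using assms by (induction i) (auto simp: load_Suc sum.distrib)

lemma greedy_run_exists:
  assumes "num_reqs I \<le> (\<Sum>j<num_sites I. c j)"
  shows "\<exists>f. greedy_run d I c f"
proof -
  define P where "P n f \<longleftrightarrow> (\<forall>i<n. f i < num_sites I \<and> load f i (f i) < c (f i) \<and>
        (\<forall>j<num_sites I. load f i j < c j \<longrightarrow>
           d (req I i) (site I (f i)) \<le> d (req I i) (site I j)))" for n f
  have step: "n \<le> num_reqs I \<Longrightarrow> \<exists>f. P n f" for n
  proof (induction n)
    case 0
    show ?case by (simp add: P_def)
  next
    case (Suc n)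
    then obtain f where f: "P n f" by auto
    let ?A = "{j. j < num_sites I \<and> load f n j < c j}"
    have "?A \<noteq> {}"
    proof
      assume "?A = {}"
      then have "(\<Sum>j<num_sites I. c j) \<le> (\<Sum>j<num_sites I. load f n j)"
        by (intro sum_mono) (metis (mono_tags, lifting) Collect_empty_eq lessThan_iff linorder_not_less)
      also have "\<dots> = n" using f by (intro sum_load) (auto simp: P_def)
      finally show False using assms Suc.prems by simp
    qed
    moreover have "finite ?A" by simp
    ultimately obtain a where a: "a \<in> ?A"
      "\<And>j. j \<in> ?A \<Longrightarrow> d (req I n) (site I a) \<le> d (req I n) (site I j)"
      using arg_min_if_finite(1)[of ?A "\<lambda>j. d (req I n) (site I j)"]
        arg_min_least[of ?A _ "\<lambda>j. d (req I n) (site I j)"] by blast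
    have l: "load (f(n := a)) i j = load f i j" if "i \<le> n" for i j
      using that by (intro load_cong) auto
    have "P (Suc n) (f(n := a))"
      using f a l by (auto simp: P_def less_Suc_eq)
    then show ?case by blast
  qed
  from step[of "num_reqs I"] obtain f where f: "P (num_reqs I) f" by auto
  define g where "g = restrict f {..<num_reqs I}"
  have "load g i j = load f i j" if "i \<le> num_reqs I" for i j
    using that by (intro load_cong) (auto simp: g_def)
  then have "greedy_run d I c g"
    using f by (auto simp: greedy_run_def assignments_def P_def g_def)
  then show ?thesis by blast
qed

lemma greedy_run_load_le:
  assumes "greedy_run d I c f" "i \<le> num_reqs I"
  shows "load f i j \<le> c j"
  using assms(2)
proof (induction i)
  case (Suc i)
  then have "load f i (f i) < c (f i)" using assms(1) by (auto simp: greedy_run_def)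
  then show ?case using Suc by (auto simp: load_Suc)
qed simp

lemma finite_feasible: "finite (feasible I)"
  by (auto simp: feasible_def assignments_def intro!: finite_PiE)

lemma feasible_nonempty:
  assumes "transport_instance M I"
  shows "feasible I \<noteq> {}"
proof -
  obtain f where f: "greedy_run (\<lambda>_ _. 0) I (cap I) f"
    using greedy_run_exists assms by (metis transport_instance_def)
  then have "f \<in> feasible I"
    using greedy_run_load_le[OF f] by (auto simp: feasible_def greedy_run_def)
  then show ?thesis by auto
qed

lemma GREEDY_nonempty:
  assumes "transport_instance M I" "k \<ge> 1"
  shows "GREEDY d k I \<noteq> {}"
proof -
  have "num_reqs I \<le> (\<Sum>j<num_sites I. cap I j)"
    using assms(1) by (simp add: transport_instance_def)
  also have "\<dots> \<le> (\<Sum>j<num_sites I. k * cap I j)"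
    using assms(2) by (intro sum_mono) simp
  finally have "\<exists>f. greedy_run d I (\<lambda>j. k * cap I j) f"
    by (rule greedy_run_exists)
  then show ?thesis by (auto simp: GREEDY_def)
qed

end

theory Submission
  imports Defs
begin

text \<open>
  Fix a greedy run \<open>f\<close> and a feasible assignment \<open>p\<close>, and let \<open>x c\<close> be the sum of the distances
  paid for request \<open>c\<close> by both. Cut the places of every site into blocks of \<open>k\<close> greedy places, one
  block for each unit of its original capacity; \<open>block k f p n q\<close> collects the requests that greedy
  puts into the block belonging to the place of \<open>q\<close> under \<open>p\<close>. For requests \<open>i\<close> and \<open>q\<close> let
  \<open>h i q\<close> be the amount by which the greedy distance of \<open>i\<close> exceeds the distance from \<open>i\<close> to the site
  \<open>p q\<close>, truncated at \<open>0\<close>. If \<open>p q\<close> is not full when \<open>i\<close> arrives, then \<open>h i q = 0\<close>. Otherwise the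
  block of \<open>q\<close> has \<open>k\<close> elements \<open>c\<close>, and each of them satisfies \<open>h i q \<le> h i c + x c\<close> by the triangle
  inequality. In both cases \<open>k * h i q\<close> is at most the sum of \<open>h i c + x c\<close> over the block, and this
  survives taking the maximum \<open>H q\<close> over all \<open>i\<close>. Since the blocks are disjoint, summing over \<open>q\<close>
  gives \<open>k * \<Sum>H \<le> \<Sum>H + \<Sum>x\<close>, and \<open>H i\<close> bounds the excess of greedy over \<open>p\<close> at \<open>i\<close>.
\<close>

lemma load_mono: "i \<le> n \<Longrightarrow> load f i j \<le> load f n j"
  unfolding load_def by (intro card_mono) auto

text \<open>For \<open>f i = j\<close>, \<open>load f i j\<close> is the place, counted from 0, that
  \<open>i\<close> takes at \<open>j\<close>; places fill in order without gaps.\<close>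

lemma bij_betw_load: "bij_betw (\<lambda>i. load f i j) {i. i < n \<and> f i = j} {..<load f n j}"
proof (induction n)
  case (Suc n)
  show ?case
  proof (cases "f n = j")
    case True
    have "{i. i < Suc n \<and> f i = j} = {i. i < n \<and> f i = j} \<union> {n}"
      using True by (auto simp: less_Suc_eq)
    moreover have "{..<load f (Suc n) j} = {..<load f n j} \<union> {load f n j}"
      using True by (auto simp: load_Suc)
    moreover have "bij_betw (\<lambda>i. load f i j) {n} {load f n j}"
      by simp
    ultimately show ?thesis
      using bij_betw_combine[OF Suc.IH, of "{n}" "{load f n j}"] by simp
  next
    case False
    then have "{i. i < Suc n \<and> f i = j} = {i. i < n \<and> f i = j}"
      by (auto simp: less_Suc_eq)
    with False Suc.IH show ?thesis
      by (simp add: load_Suc)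
  qed
qed (simp add: bij_betw_def)

lemma load_inject:
  assumes "f i = j" "f i' = j" "load f i j = load f i' j"
  shows "i = i'"
  using inj_onD[OF bij_betw_imp_inj_on[OF bij_betw_load[of f j "Suc (max i i')"]] assms(3)] assms(1,2)
  by simp

definition block :: "nat \<Rightarrow> (nat \<Rightarrow> nat) \<Rightarrow> (nat \<Rightarrow> nat) \<Rightarrow> nat \<Rightarrow> nat \<Rightarrow> nat set" where
  "block k f p n q = {c. c < n \<and> f c = p q \<and> load f c (p q) div k = load p q (p q)}"

lemma blockD: "c \<in> block k f p n q \<Longrightarrow> c < n \<and> f c = p q"
  by (simp add: block_def)

lemma finite_block: "finite (block k f p n q)"
  by (simp add: block_def)

text \<open>A common element would give \<open>q\<close> and \<open>q'\<close> the same site and the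
  same place under \<open>p\<close>.\<close>

lemma block_disjoint: "q \<noteq> q' \<Longrightarrow> block k f p n q \<inter> block k f p n q' = {}"
  using load_inject[OF refl, of p q' q] by (auto simp: block_def)

text \<open>Requests outside every block are dropped, hence the nonnegativity.\<close>

lemma sum_block_le:
  fixes y :: "nat \<Rightarrow> real"
  assumes "\<And>c. c < n \<Longrightarrow> 0 \<le> y c"
  shows "(\<Sum>q<m. \<Sum>c\<in>block k f p n q. y c) \<le> (\<Sum>c<n. y c)"
proof -
  have "(\<Sum>q<m. \<Sum>c\<in>block k f p n q. y c) = sum y (\<Union>q<m. block k f p n q)"
    by (intro sum.UNION_disjoint[symmetric])
       (simp_all add: finite_block block_disjoint)
  also have "\<dots> \<le> (\<Sum>c<n. y c)"
    using assms by (intro sum_mono2) (auto dest: blockD)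
  finally show ?thesis .
qed

text \<open>Greedy fills all places below \<open>k * a\<close>; with \<open>t < a\<close> the place
  of \<open>q\<close>, these include the \<open>k\<close> places from \<open>k * t\<close>
  on.\<close>

lemma card_block:
  assumes "load f n (p q) = k * a" "load p q (p q) < a" "k > 0"
  shows "card (block k f p n q) = k"
proof -
  let ?j = "p q" and ?t = "load p q (p q)"
  let ?l = "\<lambda>c. load f c ?j"
  have bij: "bij_betw ?l {c. c < n \<and> f c = ?j} {..<k * a}"
    using bij_betw_load[of f ?j n] assms(1) by simp
  have "k * Suc ?t \<le> k * a"
    using assms(2) by (intro mult_le_mono2) simp
  then have le: "{k * ?t..<k * ?t + k} \<subseteq> {..<k * a}"
    by auto
  have div: "u div k = ?t \<longleftrightarrow> u \<in> {k * ?t..<k * ?t + k}" for u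
    using assms(3) div_less_iff_less_mult[of k u "Suc ?t"] less_eq_div_iff_mult_less_eq[of k ?t u]
    by (auto simp: mult.commute)
  have "?l ` block k f p n q = {u \<in> ?l ` {c. c < n \<and> f c = ?j}. u div k = ?t}"
    by (auto simp: block_def)
  also have "\<dots> = {k * ?t..<k * ?t + k}"
    using le unfolding bij_betw_imp_surj_on[OF bij] div by blast
  finally have "?l ` block k f p n q = {k * ?t..<k * ?t + k}" .
  moreover have "inj_on ?l (block k f p n q)"
    using bij_betw_imp_inj_on[OF bij] by (rule inj_on_subset) (auto simp: block_def)
  ultimately show ?thesis
    by (metis card_image card_atLeastLessThan add_diff_cancel_left')
qed

lemma greedy_run_le_feasible:
  assumes "Metric_space M d" and inst: "transport_instance M I" and k: "k \<ge> 3"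
    and run: "greedy_run d I (\<lambda>j. k * cap I j) f" and p: "p \<in> feasible I"
  shows "total_distance d I f \<le> (1 + 2 / (real k - 2)) * total_distance d I p"
proof -
  interpret Metric_space M d by fact
  define n where "n = num_reqs I"
  have req: "req I i \<in> M" if "i < n" for i
    using inst that by (simp add: transport_instance_def n_def)
  have fm: "f i < num_sites I" if "i < n" for i
    using run that by (auto simp: greedy_run_def assignments_def n_def PiE_iff)
  have pm: "p i < num_sites I" if "i < n" for i
    using p that by (auto simp: feasible_def assignments_def n_def PiE_iff)
  have site: "site I j \<in> M" if "j < num_sites I" for j
    using inst that by (simp add: transport_instance_def)
  define G where "G i = d (req I i) (site I (f i))" for i
  define P where "P i = d (req I i) (site I (p i))" for i
  define x where "x i = G i + P i" for i
  define h where "h i q = max 0 (G i - d (req I i) (site I (p q)))" for i q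
  define H where "H q = Max ((\<lambda>i. h i q) ` {..<n})" for q
  have x0: "0 \<le> x i" for i by (simp add: x_def G_def P_def)
  have hH: "h i q \<le> H q" if "i < n" for i q
    unfolding H_def using that by (intro Max_ge) auto
  have H0: "0 \<le> H q" if "q < n" for q
    using hH[OF that, of q] by (simp add: h_def)
  have step: "real k * h i q \<le> (\<Sum>c\<in>block k f p n q. H c + x c)" if i: "i < n" and q: "q < n" for i q
  proof (cases "load f i (p q) < k * cap I (p q)")
    case True
    then have "h i q = 0"
      using run i pm[OF q] by (auto simp: greedy_run_def h_def G_def n_def)
    moreover have "0 \<le> (\<Sum>c\<in>block k f p n q. H c + x c)"
      using H0 x0 by (intro sum_nonneg add_nonneg_nonneg) (auto dest: blockD)
    ultimately show ?thesis by simp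
  next
    case False
    \<comment> \<open>A site that is full when \<open>i\<close> arrives stays full.\<close>
    have "load f n (p q) = k * cap I (p q)"
      using False greedy_run_load_le[OF run, of n "p q"] load_mono[of i n f "p q"] i
      by (simp add: n_def)
    moreover have "load p q (p q) < cap I (p q)"
    proof -
      \<comment> \<open>\<open>Suc q\<close> counts \<open>q\<close> itself, which makes the bound
        strict.\<close>
      have "load p (Suc q) (p q) \<le> load p n (p q)"
        using q by (intro load_mono) simp
      also have "\<dots> \<le> cap I (p q)"
        using p pm[OF q] by (simp add: feasible_def n_def)
      finally show ?thesis by (simp add: load_Suc)
    qed
    ultimately have "card (block k f p n q) = k"
      using k by (intro card_block) auto
    then have "real k * h i q = (\<Sum>c\<in>block k f p n q. h i q)"
      by simp
    also have "\<dots> \<le> (\<Sum>c\<in>block k f p n q. H c + x c)"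
    proof (intro sum_mono)
      fix c assume "c \<in> block k f p n q"
      then have c: "c < n" "f c = p q" by (auto dest: blockD)
      have "d (req I i) (site I (p c)) \<le> d (req I i) (site I (p q)) + d (site I (p q)) (site I (p c))"
        by (intro triangle req site pm i q c(1))
      also have "d (site I (p q)) (site I (p c)) \<le> d (site I (p q)) (req I c) + P c"
        unfolding P_def by (intro triangle req site pm q c(1))
      also have "d (site I (p q)) (req I c) = G c"
        by (simp add: G_def c(2) commute)
      \<comment> \<open>Truncation is harmless, as \<open>h i c\<close> and \<open>x c\<close> are
        nonnegative.\<close>
      finally have "h i q \<le> h i c + x c"
        using x0[of c] by (simp add: h_def x_def)
      with hH[OF i, of c] show "h i q \<le> H c + x c" by simp
    qed
    finally show ?thesis .
  qed
  have "real k * H q \<le> (\<Sum>c\<in>block k f p n q. H c + x c)" if "q < n" for q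
  proof -
    have "H q \<in> (\<lambda>i. h i q) ` {..<n}"
      unfolding H_def using that by (intro Max_in) auto
    then show ?thesis using step that by auto
  qed
  then have "real k * (\<Sum>q<n. H q) \<le> (\<Sum>q<n. \<Sum>c\<in>block k f p n q. H c + x c)"
    unfolding sum_distrib_left by (intro sum_mono) simp
  also have "\<dots> \<le> (\<Sum>c<n. H c + x c)"
    using H0 x0 by (intro sum_block_le add_nonneg_nonneg)
  finally have sumH: "(real k - 1) * (\<Sum>q<n. H q) \<le> (\<Sum>i<n. x i)"
    by (simp add: sum.distrib algebra_simps)
  define SG where "SG = (\<Sum>i<n. G i)"
  define SP where "SP = (\<Sum>i<n. P i)"
  have "G i - P i \<le> H i" if "i < n" for i
    using hH[OF that, of i] by (simp add: h_def P_def)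
  then have "SG - SP \<le> (\<Sum>q<n. H q)"
    unfolding SG_def SP_def sum_subtractf[symmetric] by (intro sum_mono) simp
  then have "(real k - 1) * (SG - SP) \<le> (real k - 1) * (\<Sum>q<n. H q)"
    using k by (intro mult_left_mono) auto
  also have "\<dots> \<le> SG + SP"
    using sumH by (simp add: x_def sum.distrib SG_def SP_def)
  finally have "(real k - 2) * SG \<le> real k * SP"
    by (simp add: algebra_simps)
  \<comment> \<open>Division by \<open>k - 2\<close> is where \<open>k \<ge> 3\<close>
    matters.\<close>
  then have "SG \<le> (1 + 2 / (real k - 2)) * SP"
    using k by (simp add: field_simps)
  then show ?thesis
    by (simp add: total_distance_def SG_def SP_def G_def P_def n_def)
qed

theorem theorem1:
  fixes M :: "'a set" and d :: "'a \<Rightarrow> 'a \<Rightarrow> real"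
    and I :: "'a transport" and k :: nat and g :: real
  assumes "Metric_space M d"
    and "transport_instance M I"
    and "k \<ge> 3"
    and "g \<in> GREEDY d k I"
  shows "g \<le> (1 + 2 / (real k - 2)) * OPT d I"
proof -
  obtain f where f: "greedy_run d I (\<lambda>j. k * cap I j) f" "g = total_distance d I f"
    using assms(4) by (auto simp: GREEDY_def)
  have "OPT d I \<in> total_distance d I ` feasible I"
    unfolding OPT_def using feasible_nonempty[OF assms(2)] finite_feasible by (intro Min_in) auto
  then show ?thesis
    using greedy_run_le_feasible[OF assms(1-3) f(1)] f(2) by auto
qed

end
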